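(* Let $N\ge 1$, let $\Omega\subset\mathbb{R}^N$ be a bounded domain with a Lipschitz continuous boundary, and let $0<s<1$. Let $\mathcal O\subset\mathbb{R}^N\setminus\Omega$ be an arbitrary non-empty open set. Let $\lambda>0$ and let $\varphi\in D((-\Delta)_D^s)$ satisfy $$ \begin{cases} (-\Delta)_D^s\varphi=\lambda\varphi & \text{in }\Omega,\\ \mathcal N_s\varphi=0 & \text{in }\mathcal O. \end{cases} $$ Then $\varphi=0$ in $\mathbb{R}^N$.
   Context: Constant: $C_{N,s}=\frac{s2^{2s}\Gamma(\frac{2s+N}{2})}{\pi^{N/2}\Gamma(1-s)}$. $W^{s,2}(\mathbb{R}^N)$ is the space of $u\in L^2(\mathbb{R}^N)$ with $\int_{\mathbb{R}^N}\int_{\mathbb{R}^N}\frac{|u(x)-u(y)|^2}{|x-y|^{N+2s}}\,dxdy<\infty$, and $W_0^{s,2}(\overline\Omega)=\{u\in W^{s,2}(\mathbb{R}^N): u=0\text{ in }\mathbb{R}^N\setminus\Omega\}$. $(-\Delta)_D^s$ is the realization in $L^2(\Omega)$ of the fractional Laplacian with zero exterior condition: the selfadjoint operator on $L^2(\Omega)$ associated with the form $\mathcal F(u,v)=\frac{C_{N,s}}{2}\int_{\mathbb{R}^N}\int_{\mathbb{R}^N}\frac{(u(x)-u(y))(v(x)-v(y))}{|x-y|^{N+2s}}\,dxdy$, $u,v\in W_0^{s,2}(\overline\Omega)$. That is, $u\in D((-\Delta)_D^s)$ with $(-\Delta)_D^su=f$ iff $u\in W_0^{s,2}(\overline\Omega)$,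 $f\in L^2(\Omega)$ and $\mathcal F(u,v)=(f,v)_{L^2(\Omega)}$ for all $v\in W_0^{s,2}(\overline\Omega)$. Nonlocal normal derivative: for $u\in W^{s,2}(\mathbb{R}^N)$, $\mathcal N_su(x)=C_{N,s}\int_\Omega\frac{u(x)-u(y)}{|x-y|^{N+2s}}\,dy$ for $x\in\mathbb{R}^N\setminus\overline\Omega$. *)

theory Defs
  imports "HOL-Analysis.Analysis"
begin

text \<open>
  The space \<open>\<real>\<^sup>N\<close> is an arbitrary Euclidean space \<open>'a\<close>, so that \<open>N = DIM('a) \<ge> 1\<close>. Elements of
  \<open>L\<^sup>2\<close> and of the Sobolev spaces are represented by measurable functions. All the notions below
  that concern them are invariant under modification on Lebesgue null sets, and pointwise
  conditions on them are read almost everywhere.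
\<close>

definition frac_const :: "nat \<Rightarrow> real \<Rightarrow> real" where
  "frac_const N s =
     s * 2 powr (2 * s) * Gamma ((2 * s + real N) / 2) / (pi powr (real N / 2) * Gamma (1 - s))"

definition L2_fun :: "'b measure \<Rightarrow> ('b \<Rightarrow> real) set" where
  "L2_fun M = {u. u \<in> borel_measurable M \<and> integrable M (\<lambda>x. (u x)\<^sup>2)}"

text \<open>
  The double integrals over \<open>\<real>\<^sup>N \<times> \<real>\<^sup>N\<close> are taken with respect to Lebesgue measure on \<open>'a \<times> 'a\<close>.
  On the diagonal, a null set, the integrands have the value \<open>0\<close>.
\<close>

definition frac_sobolev :: "real \<Rightarrow> ('a::euclidean_space \<Rightarrow> real) set" where
  "frac_sobolev s = {u \<in> L2_fun lebesgue.
     (\<integral>\<^sup>+(x, y). ennreal (\<bar>u x - u y\<bar>\<^sup>2 / norm (x - y) powr (real DIM('a) + 2 * s))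
        \<partial>(lebesgue :: ('a \<times> 'a) measure)) < \<infinity>}"

definition frac_sobolev0 :: "real \<Rightarrow> 'a::euclidean_space set \<Rightarrow> ('a \<Rightarrow> real) set" where
  "frac_sobolev0 s \<Omega> = {u \<in> frac_sobolev s. AE x in lebesgue. x \<notin> \<Omega> \<longrightarrow> u x = 0}"

definition frac_form :: "real \<Rightarrow> ('a::euclidean_space \<Rightarrow> real) \<Rightarrow> ('a \<Rightarrow> real) \<Rightarrow> real" where
  "frac_form s u v = frac_const DIM('a) s / 2 *
     (\<integral>(x, y). (u x - u y) * (v x - v y) / norm (x - y) powr (real DIM('a) + 2 * s)
        \<partial>(lebesgue :: ('a \<times> 'a) measure))"

text \<open>
  \<open>dirichlet_frac_laplacian s \<Omega> u f\<close> is the graph of the operator \<open>(-\<Delta>)\<^sub>D\<^sup>s\<close>: it says that \<open>u\<close>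
  belongs to the domain and is mapped to \<open>f\<close>. A graph is used because \<open>f\<close> is determined only
  almost everywhere in \<open>\<Omega>\<close>. An element \<open>u\<close> of the domain is given by its extension by zero
  to the whole space.
\<close>

definition dirichlet_frac_laplacian ::
    "real \<Rightarrow> 'a::euclidean_space set \<Rightarrow> ('a \<Rightarrow> real) \<Rightarrow> ('a \<Rightarrow> real) \<Rightarrow> bool" where
  "dirichlet_frac_laplacian s \<Omega> u f \<longleftrightarrow>
     u \<in> frac_sobolev0 s \<Omega> \<and> f \<in> L2_fun (lebesgue_on \<Omega>) \<and>
     (\<forall>v \<in> frac_sobolev0 s \<Omega>. frac_form s u v = (\<integral>x. f x * v x \<partial>lebesgue_on \<Omega>))"

definition dirichlet_frac_laplacian_dom ::
    "real \<Rightarrow> 'a::euclidean_space set \<Rightarrow> ('a \<Rightarrow> real) set" where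
  "dirichlet_frac_laplacian_dom s \<Omega> = {u. \<exists>f. dirichlet_frac_laplacian s \<Omega> u f}"

text \<open>
  The nonlocal normal derivative is meaningful for \<open>x\<close> outside the closure of \<open>\<Omega>\<close>; for bounded
  \<open>\<Omega>\<close> the integrand is then integrable.
\<close>

definition nonlocal_normal_deriv ::
    "real \<Rightarrow> 'a::euclidean_space set \<Rightarrow> ('a \<Rightarrow> real) \<Rightarrow> 'a \<Rightarrow> real" where
  "nonlocal_normal_deriv s \<Omega> u x = frac_const DIM('a) s *
     (\<integral>y. (u x - u y) / norm (x - y) powr (real DIM('a) + 2 * s) \<partial>lebesgue_on \<Omega>)"

text \<open>
  Near each boundary point, in suitable orthonormal coordinates whose last axis is spanned by the
  unit vector \<open>e\<close>, \<open>\<Omega>\<close> lies strictly above the graph of a Lipschitz function \<open>g\<close> of the remaining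
  coordinates, i.e. of the orthogonal projection \<open>x - (x \<bullet> e) *\<^sub>R e\<close>. In dimension one the
  hyperplane is \<open>{0}\<close> and \<open>g\<close> is a constant.
\<close>

definition lipschitz_boundary :: "'a::euclidean_space set \<Rightarrow> bool" where
  "lipschitz_boundary \<Omega> \<longleftrightarrow>
     (\<forall>p \<in> frontier \<Omega>. \<exists>r > 0. \<exists>e g L. norm e = 1 \<and> L-lipschitz_on {z. z \<bullet> e = 0} g \<and>
        \<Omega> \<inter> ball p r = {x \<in> ball p r. x \<bullet> e > (g (x - (x \<bullet> e) *\<^sub>R e) :: real)})"

end

theory Submission
  imports Defs "HOL-Real_Asymp.Real_Asymp"
begin

text \<open>
  Outside \<open>\<Omega>\<close> the function \<open>\<phi>\<close> vanishes, so on \<open>\<O>\<close> the nonlocal normal derivative is, up to a nonzero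
  factor, the potential \<open>\<integral>\<^bsub>\<Omega>\<^esub> \<phi>(y) |x - y|\<^bsup>-2b\<^esup> dy\<close> with \<open>2b = N + 2s\<close>. This potential alone
  determines \<open>\<phi>\<close>: if it vanishes on a ball \<open>B\<close> at positive distance from the bounded set \<open>\<Omega>\<close>, then
  \<open>\<phi> = 0\<close>. The point is that the kernels \<open>y \<mapsto> |x - y|\<^bsup>-2b\<^esup>\<close>, \<open>x \<in> B\<close>, together with everything that is
  obtained from them by differentiation in \<open>x\<close>, linear combination and uniform limits, exhaust the
  continuous functions, and all of these operations preserve annihilation by \<open>\<phi>\<close>.

  The Laplacian in \<open>x\<close> maps \<open>|x - y|\<^bsup>-2b\<^esup>\<close> to \<open>2b(2b + 2 - N) |x - y|\<^bsup>-2b-2\<^esup>\<close>, and the factor is not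
  zero because \<open>2b \<ge> N\<close>. Hence \<open>\<phi>\<close> annihilates \<open>|x - y|\<^bsup>-2b-2n\<^esup>\<close> for all \<open>n\<close>
  (\<open>riesz_powers_annihilated\<close>). For fixed \<open>x\<close> these are \<open>|x - y|\<^bsup>-2b\<^esup>\<close> times the powers of
  \<open>u = |x - y|\<^bsup>-2\<^esup>\<close>, which stays in a compact interval; by the Weierstrass theorem in the single
  variable \<open>u\<close>, \<open>\<phi>\<close> annihilates every continuous function of \<open>|x - y|\<close>, in particular the Gaussian
  (\<open>gaussian_annihilated\<close>). Since
  \<open>exp (-|x - y|\<^sup>2) = exp (-|x|\<^sup>2) exp (-|y|\<^sup>2) exp (2 x \<bullet> y)\<close>, differentiating the last factor in \<open>x\<close>
  produces all polynomials in \<open>y\<close> (\<open>polynomial_exponential_annihilated\<close>), and the Stone-Weierstrass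
  theorem gives all continuous functions. Approximating the sign of \<open>\<phi>\<close> by continuous functions
  then yields \<open>\<integral> |\<phi>| = 0\<close>.
\<close>

section \<open>Annihilation under limits\<close>

lemma integrable_times_bounded:
  fixes f g :: "'b \<Rightarrow> real"
  assumes f: "integrable M f" and g: "g \<in> borel_measurable M"
    and bound: "\<And>y. y \<in> space M \<Longrightarrow> \<bar>g y\<bar> \<le> C"
  shows "integrable M (\<lambda>y. f y * g y)"
proof (rule Bochner_Integration.integrable_bound)
  show "integrable M (\<lambda>y. C * f y)" using f by simp
  show "(\<lambda>y. f y * g y) \<in> borel_measurable M"
    using f g by measurable
  show "AE y in M. norm (f y * g y) \<le> norm (C * f y)"
  proof (rule AE_I2)
    fix y assume "y \<in> space M"
    from bound[OF this] have "\<bar>g y\<bar> \<le> \<bar>C\<bar>" by linarith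
    then show "norm (f y * g y) \<le> norm (C * f y)"
      by (simp add: abs_mult mult.commute[of "\<bar>C\<bar>"] mult_left_mono)
  qed
qed

text \<open>
  The difference quotients of \<open>k\<close> at \<open>0\<close> are annihilated, and by the mean value theorem they are
  bounded by \<open>C\<close>, so dominated convergence carries the annihilation over to the derivative.
\<close>

lemma integral_derivative_eq_0:
  fixes f :: "'b \<Rightarrow> real" and k k' :: "real \<Rightarrow> 'b \<Rightarrow> real"
  assumes f: "integrable M f" and \<delta>: "0 < \<delta>"
    and meas: "\<And>t. \<bar>t\<bar> < \<delta> \<Longrightarrow> k t \<in> borel_measurable M"
    and int: "\<And>t. \<bar>t\<bar> < \<delta> \<Longrightarrow> integrable M (\<lambda>y. f y * k t y)"
    and deriv: "\<And>t y. \<bar>t\<bar> < \<delta> \<Longrightarrow> y \<in> space M \<Longrightarrow>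
                  ((\<lambda>t. k t y) has_real_derivative k' t y) (at t)"
    and bound: "\<And>t y. \<bar>t\<bar> < \<delta> \<Longrightarrow> y \<in> space M \<Longrightarrow> \<bar>k' t y\<bar> \<le> C"
    and zero: "\<And>t. \<bar>t\<bar> < \<delta> \<Longrightarrow> (\<integral>y. f y * k t y \<partial>M) = 0"
  shows "(\<integral>y. f y * k' 0 y \<partial>M) = 0"
proof -
  define h where "h n = \<delta> / real (n + 2)" for n :: nat
  have h: "0 < h n" "h n < \<delta>" for n
    using \<delta> by (auto simp: h_def divide_simps)
  have h_lim: "h \<longlonglongrightarrow> 0"
    unfolding h_def by real_asymp
  define q where "q n y = (k (h n) y - k 0 y) / h n" for n y
  have q_meas [measurable]: "q n \<in> borel_measurable M" for n
  proof -
    have [measurable]: "k (h n) \<in> borel_measurable M" "k 0 \<in> borel_measurable M"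
      using meas h[of n] \<delta> by auto
    show ?thesis unfolding q_def by measurable
  qed
  have q_lim: "(\<lambda>n. q n y) \<longlonglongrightarrow> k' 0 y" if "y \<in> space M" for y
  proof -
    have "((\<lambda>t. (k t y - k 0 y) / t) \<longlongrightarrow> k' 0 y) (at 0)"
      using deriv[of 0 y] \<delta> that by (simp add: has_field_derivative_iff)
    moreover have "filterlim h (at 0) sequentially"
      unfolding filterlim_at using h_lim h(1) by (auto simp: less_le intro: always_eventually)
    ultimately show ?thesis
      unfolding q_def by (rule filterlim_compose)
  qed
  have q_bound: "\<bar>q n y\<bar> \<le> C" if "y \<in> space M" for n y
  proof -
    have "\<exists>z>0. z < h n \<and> k (h n) y - k 0 y = (h n - 0) * k' z y"
      by (rule MVT2) (use h(1)[of n] h(2)[of n] that in \<open>auto intro!: deriv\<close>)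
    then obtain z where "z > 0" "z < h n" "q n y = k' z y"
      using h(1)[of n] by (auto simp: q_def)
    then show ?thesis using bound[of z y] that h(2)[of n] by auto
  qed
  have [measurable]: "f \<in> borel_measurable M" using f by measurable
  have [measurable]: "k' 0 \<in> borel_measurable M"
    by (rule borel_measurable_LIMSEQ_real[OF q_lim q_meas])
  have "(\<lambda>n. \<integral>y. f y * q n y \<partial>M) \<longlonglongrightarrow> (\<integral>y. f y * k' 0 y \<partial>M)"
  proof (rule integral_dominated_convergence)
    show "integrable M (\<lambda>y. C * \<bar>f y\<bar>)" using f by simp
    show "AE y in M. (\<lambda>n. f y * q n y) \<longlonglongrightarrow> f y * k' 0 y"
      by (auto intro!: tendsto_mult q_lim)
    show "AE y in M. norm (f y * q n y) \<le> C * \<bar>f y\<bar>" for n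
      using q_bound by (auto simp: abs_mult mult.commute[of C] intro!: mult_left_mono)
  qed measurable
  moreover have "(\<integral>y. f y * q n y \<partial>M) = 0" for n
  proof -
    have "(\<integral>y. f y * q n y \<partial>M) = (\<integral>y. (f y * k (h n) y - f y * k 0 y) / h n \<partial>M)"
      by (simp add: q_def algebra_simps)
    also have "\<dots> = ((\<integral>y. f y * k (h n) y \<partial>M) - (\<integral>y. f y * k 0 y \<partial>M)) / h n"
      using int[of "h n"] int[of 0] h[of n] \<delta> by simp
    also have "\<dots> = 0"
      using zero[of "h n"] zero[of 0] h[of n] \<delta> by simp
    finally show ?thesis .
  qed
  ultimately show ?thesis
    by (simp add: LIMSEQ_const_iff)
qed

text \<open>
  The map \<open>u\<close> allows two uses of the same approximation argument: with \<open>u\<close> the inverse squared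
  distance to a point it is the Weierstrass theorem in one variable, and with \<open>u\<close> the identity it
  reaches all continuous functions on \<open>\<real>\<^sup>N\<close>.
\<close>

lemma continuous_annihilated_if_polynomials_annihilated:
  fixes f :: "'b \<Rightarrow> real" and u :: "'b \<Rightarrow> 'a::euclidean_space" and h :: "'a \<Rightarrow> real"
  assumes f: "integrable M f" and u [measurable]: "u \<in> borel_measurable M"
    and S: "compact S" "\<And>y. y \<in> space M \<Longrightarrow> u y \<in> S"
    and h: "continuous_on S h"
    and zero: "\<And>p. real_polynomial_function p \<Longrightarrow> (\<integral>y. f y * p (u y) \<partial>M) = 0"
  shows "(\<integral>y. f y * h (u y) \<partial>M) = 0"
proof -
  have "\<forall>n. \<exists>p. real_polynomial_function p \<and> (\<forall>z\<in>S. \<bar>h z - p z\<bar> < 1 / real (Suc n))"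
    using Stone_Weierstrass_real_polynomial_function[OF S(1) h] by (metis of_nat_0_less_iff zero_less_Suc zero_less_divide_1_iff)
  then obtain p where poly: "\<And>n. real_polynomial_function (p n)"
    and approx: "\<And>n z. z \<in> S \<Longrightarrow> \<bar>h z - p n z\<bar> < 1 / real (Suc n)"
    by metis
  obtain B where B: "\<And>z. z \<in> S \<Longrightarrow> \<bar>h z\<bar> \<le> B"
    using compact_imp_bounded[OF compact_continuous_image[OF h S(1)]]
    by (auto simp: bounded_iff)
  have [measurable]: "f \<in> borel_measurable M" using f by measurable
  have pm [measurable]: "(\<lambda>y. p n (u y)) \<in> borel_measurable M" for n
    by (intro measurable_compose[OF u] borel_measurable_continuous_onI
        continuous_on_polymonial_function)
      (use poly real_polynomial_function_eq in blast)
  have lim: "(\<lambda>n. p n (u y)) \<longlonglongrightarrow> h (u y)" if "y \<in> space M" for y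
  proof -
    have "(\<lambda>n. h (u y) - p n (u y)) \<longlonglongrightarrow> 0"
      by (rule Lim_null_comparison[where g = "\<lambda>n. 1 / real (Suc n)"])
        (use approx[OF S(2)[OF that]] in \<open>auto intro!: always_eventually less_imp_le, real_asymp\<close>)
    then have "(\<lambda>n. h (u y) - (h (u y) - p n (u y))) \<longlonglongrightarrow> h (u y) - 0"
      by (intro tendsto_diff tendsto_const)
    then show ?thesis by simp
  qed
  have [measurable]: "(\<lambda>y. h (u y)) \<in> borel_measurable M"
    by (rule borel_measurable_LIMSEQ_real[OF lim pm])
  have "(\<lambda>n. \<integral>y. f y * p n (u y) \<partial>M) \<longlonglongrightarrow> (\<integral>y. f y * h (u y) \<partial>M)"
  proof (rule integral_dominated_convergence)
    show "integrable M (\<lambda>y. (B + 1) * \<bar>f y\<bar>)" using f by simp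
    show "AE y in M. (\<lambda>n. f y * p n (u y)) \<longlonglongrightarrow> f y * h (u y)"
      by (auto intro!: tendsto_mult lim)
    show "AE y in M. norm (f y * p n (u y)) \<le> (B + 1) * \<bar>f y\<bar>" for n
    proof (rule AE_I2)
      fix y assume y: "y \<in> space M"
      have "1 / real (Suc n) \<le> 1" by simp
      then have "\<bar>p n (u y)\<bar> \<le> B + 1"
        using approx[OF S(2)[OF y], of n] B[OF S(2)[OF y]] by linarith
      then show "norm (f y * p n (u y)) \<le> (B + 1) * \<bar>f y\<bar>"
        by (simp add: abs_mult mult.commute[of "B + 1"] mult_left_mono)
    qed
  qed measurable
  then show ?thesis
    by (simp add: zero[OF poly] LIMSEQ_const_iff)
qed

text \<open>
  The sign of \<open>f\<close> is an almost everywhere limit of continuous functions. Truncating these to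
  \<open>[-1, 1]\<close> makes \<open>\<bar>f\<bar>\<close> a dominating function, and the limit of their integrals against \<open>f\<close> is
  \<open>\<integral> \<bar>f\<bar>\<close>.
\<close>

lemma AE_eq_0_if_continuous_annihilated:
  fixes f :: "'a::euclidean_space \<Rightarrow> real"
  assumes S: "S \<in> sets lebesgue" and f: "integrable (lebesgue_on S) f"
    and zero: "\<And>h. continuous_on UNIV h \<Longrightarrow> (\<integral>y. f y * h y \<partial>lebesgue_on S) = 0"
  shows "AE y in lebesgue_on S. f y = 0"
proof -
  have fm [measurable]: "f \<in> borel_measurable (lebesgue_on S)" using f by measurable
  have "(\<lambda>y. sgn (f y)) measurable_on S"
    unfolding measurable_on_iff_borel_measurable[OF S] by measurable
  then obtain N g where N: "negligible N" and g: "\<And>n. continuous_on UNIV (g n)"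
    and lim: "\<And>y. y \<notin> N \<Longrightarrow> (\<lambda>n. g n y) \<longlonglongrightarrow> (if y \<in> S then sgn (f y) else 0)"
    unfolding measurable_on_def by blast
  have AE_lim: "AE y in lebesgue_on S. (\<lambda>n. g n y) \<longlonglongrightarrow> sgn (f y)"
  proof -
    have "AE y in lebesgue. y \<notin> N"
      using N by (simp add: AE_not_in negligible_iff_null_sets)
    then have "AE y in lebesgue. y \<in> S \<longrightarrow> (\<lambda>n. g n y) \<longlonglongrightarrow> sgn (f y)"
      by eventually_elim (use lim in fastforce)
    then show ?thesis using S by (simp add: AE_restrict_space_iff)
  qed
  define c where "c n y = max (-1) (min 1 (g n y))" for n y
  have c_cont: "continuous_on UNIV (c n)" for n
    unfolding c_def by (intro continuous_intros g)
  have [measurable]: "c n \<in> borel_measurable (lebesgue_on S)" for n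
    using continuous_imp_measurable_on_sets_lebesgue[OF continuous_on_subset[OF c_cont] S] by auto
  have "(\<lambda>n. \<integral>y. f y * c n y \<partial>lebesgue_on S) \<longlonglongrightarrow> (\<integral>y. \<bar>f y\<bar> \<partial>lebesgue_on S)"
  proof (rule integral_dominated_convergence)
    show "integrable (lebesgue_on S) (\<lambda>y. \<bar>f y\<bar>)" using f by simp
    show "AE y in lebesgue_on S. (\<lambda>n. f y * c n y) \<longlonglongrightarrow> \<bar>f y\<bar>"
      using AE_lim
    proof eventually_elim
      fix y assume "(\<lambda>n. g n y) \<longlonglongrightarrow> sgn (f y)"
      then have "(\<lambda>n. f y * c n y) \<longlonglongrightarrow> f y * max (-1) (min 1 (sgn (f y)))"
        unfolding c_def by (intro tendsto_intros)
      moreover have "f y * max (-1) (min 1 (sgn (f y))) = \<bar>f y\<bar>"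
        by (auto simp: sgn_if)
      ultimately show "(\<lambda>n. f y * c n y) \<longlonglongrightarrow> \<bar>f y\<bar>"
        by simp
    qed
    show "AE y in lebesgue_on S. norm (f y * c n y) \<le> \<bar>f y\<bar>" for n
    proof (rule AE_I2)
      fix y
      have "\<bar>c n y\<bar> \<le> 1" by (auto simp: c_def)
      then show "norm (f y * c n y) \<le> \<bar>f y\<bar>"
        by (simp add: abs_mult mult_left_le)
    qed
  qed measurable
  then have "(\<integral>y. \<bar>f y\<bar> \<partial>lebesgue_on S) = 0"
    by (simp add: zero[OF c_cont] LIMSEQ_const_iff)
  then show ?thesis
    using f by (subst (asm) integral_nonneg_eq_0_iff_AE) auto
qed


section \<open>Sources separated from the observation set\<close>

lemma DERIV_inner_self_powr:
  fixes x y e :: "'a::euclidean_space"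
  assumes "x \<noteq> y"
  shows "((\<lambda>t. ((x + t *\<^sub>R e - y) \<bullet> (x + t *\<^sub>R e - y)) powr c) has_real_derivative
           2 * c * ((x - y) \<bullet> e) * ((x - y) \<bullet> (x - y)) powr (c - 1)) (at 0)"
proof -
  have eq: "(x + t *\<^sub>R e - y) \<bullet> (x + t *\<^sub>R e - y)
      = (x - y) \<bullet> (x - y) + 2 * t * ((x - y) \<bullet> e) + t\<^sup>2 * (e \<bullet> e)" for t
    by (simp add: inner_simps algebra_simps inner_commute power2_eq_square)
  have "0 < (x - y) \<bullet> (x - y)" using assms by simp
  then show ?thesis
    unfolding eq by (auto intro!: derivative_eq_intros)
qed

text \<open>
  The source \<open>f\<close> lives on the bounded set \<open>space M\<close> and is observed from the bounded open set \<open>B\<close>. The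
  distance \<open>d\<close> between the two keeps all the kernels and their derivatives bounded, which makes
  differentiation in the observation point legitimate.
\<close>

context
  fixes M :: "'a::euclidean_space measure" and f :: "'a \<Rightarrow> real" and B :: "'a set" and d R :: real
  assumes id_measurable: "(\<lambda>y. y) \<in> borel_measurable M"
    and f: "integrable M f"
    and B: "open B"
    and d: "0 < d"
    and R: "0 < R"
    and separated: "\<And>x y. x \<in> B \<Longrightarrow> y \<in> space M \<Longrightarrow> d \<le> norm (x - y)"
    and norm_obs: "\<And>x. x \<in> B \<Longrightarrow> norm x \<le> R"
    and norm_source: "\<And>y. y \<in> space M \<Longrightarrow> norm y \<le> R"
begin

lemma measurable_continuous: "continuous_on UNIV g \<Longrightarrow> g \<in> borel_measurable M"
  for g :: "'a \<Rightarrow> real"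
  using measurable_compose[OF id_measurable borel_measurable_continuous_onI] by simp

lemma measurable_kernel:
  "(\<lambda>y. ((x - y) \<bullet> (x - y)) powr c) \<in> borel_measurable M"
  "(\<lambda>y. (x - y) \<bullet> e) \<in> borel_measurable M"
proof -
  have [measurable]: "(\<lambda>y. (x - y) \<bullet> (x - y)) \<in> borel_measurable M"
    by (intro measurable_continuous continuous_intros)
  show "(\<lambda>y. ((x - y) \<bullet> (x - y)) powr c) \<in> borel_measurable M"
    by measurable
  show "(\<lambda>y. (x - y) \<bullet> e) \<in> borel_measurable M"
    by (intro measurable_continuous continuous_intros)
qed

lemma dist_sq_bounds:
  assumes "x \<in> B" "y \<in> space M"
  shows "d\<^sup>2 \<le> (x - y) \<bullet> (x - y)" "(x - y) \<bullet> (x - y) \<le> (2 * R)\<^sup>2"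
    "0 < (x - y) \<bullet> (x - y)" "x \<noteq> y"
proof -
  show 1: "d\<^sup>2 \<le> (x - y) \<bullet> (x - y)"
    using separated[OF assms] d
    unfolding power2_norm_eq_inner[symmetric] by (intro power_mono) auto
  have "norm (x - y) \<le> 2 * R"
    using norm_triangle_ineq4[of x y] norm_obs[OF assms(1)] norm_source[OF assms(2)] by linarith
  then show "(x - y) \<bullet> (x - y) \<le> (2 * R)\<^sup>2"
    unfolding power2_norm_eq_inner[symmetric] by (intro power_mono) auto
  have "0 < d\<^sup>2" using d by simp
  with 1 show "0 < (x - y) \<bullet> (x - y)" by linarith
  then show "x \<noteq> y" by auto
qed

lemma kernel_bound:
  assumes "x \<in> B" "y \<in> space M" "c \<le> 0"
  shows "\<bar>((x - y) \<bullet> (x - y)) powr c\<bar> \<le> d\<^sup>2 powr c"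
  using dist_sq_bounds[OF assms(1,2)] d assms(3) by (auto intro!: powr_mono2')

lemma component_bound:
  assumes "x \<in> B" "y \<in> space M" "e \<in> Basis"
  shows "\<bar>(x - y) \<bullet> e\<bar> \<le> 2 * R"
  using Basis_le_norm[OF assms(3), of "x - y"] norm_triangle_ineq4[of x y]
    norm_obs[OF assms(1)] norm_source[OF assms(2)] by linarith

lemma directional_derivative_annihilated:
  fixes K D :: "'a \<Rightarrow> 'a \<Rightarrow> real" and e :: 'a
  assumes meas: "\<And>x. x \<in> B \<Longrightarrow> K x \<in> borel_measurable M"
    and K_bound: "\<And>x y. x \<in> B \<Longrightarrow> y \<in> space M \<Longrightarrow> \<bar>K x y\<bar> \<le> C"
    and deriv: "\<And>x y. x \<in> B \<Longrightarrow> y \<in> space M \<Longrightarrow>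
                  ((\<lambda>t. K (x + t *\<^sub>R e) y) has_real_derivative D x y) (at 0)"
    and D_bound: "\<And>x y. x \<in> B \<Longrightarrow> y \<in> space M \<Longrightarrow> \<bar>D x y\<bar> \<le> C'"
    and zero: "\<And>x. x \<in> B \<Longrightarrow> (\<integral>y. f y * K x y \<partial>M) = 0"
    and x: "x \<in> B"
  shows "(\<integral>y. f y * D x y \<partial>M) = 0"
proof -
  obtain \<epsilon> where \<epsilon>: "0 < \<epsilon>" "ball x \<epsilon> \<subseteq> B"
    using B x open_contains_ball by blast
  define \<delta> where "\<delta> = \<epsilon> / (1 + norm e)"
  have pos: "0 < 1 + norm e" by (simp add: add_pos_nonneg)
  have \<delta>: "0 < \<delta>" using \<epsilon>(1) pos by (simp add: \<delta>_def)
  have in_B: "x + t *\<^sub>R e \<in> B" if "\<bar>t\<bar> < \<delta>" for t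
  proof -
    have "\<bar>t\<bar> * norm e \<le> \<bar>t\<bar> * (1 + norm e)" by (simp add: mult_left_mono)
    also have "\<dots> < \<epsilon>" using that pos by (simp add: \<delta>_def pos_less_divide_eq)
    finally have "x + t *\<^sub>R e \<in> ball x \<epsilon>" by (simp add: dist_norm)
    then show ?thesis using \<epsilon>(2) by blast
  qed
  have "(\<integral>y. f y * D (x + 0 *\<^sub>R e) y \<partial>M) = 0"
  proof (rule integral_derivative_eq_0[where k = "\<lambda>t. K (x + t *\<^sub>R e)"
        and k' = "\<lambda>t. D (x + t *\<^sub>R e)" and C = C', OF f \<delta>])
    fix t :: real assume t: "\<bar>t\<bar> < \<delta>"
    show "K (x + t *\<^sub>R e) \<in> borel_measurable M" using meas in_B[OF t] .
    then show "integrable M (\<lambda>y. f y * K (x + t *\<^sub>R e) y)"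
      using K_bound[OF in_B[OF t]] by (rule integrable_times_bounded[OF f])
    show "(\<integral>y. f y * K (x + t *\<^sub>R e) y \<partial>M) = 0" using zero in_B[OF t] .
    fix y assume y: "y \<in> space M"
    show "\<bar>D (x + t *\<^sub>R e) y\<bar> \<le> C'" using D_bound[OF in_B[OF t] y] .
    have "((\<lambda>h. K (x + (h + t) *\<^sub>R e) y) has_real_derivative D (x + t *\<^sub>R e) y) (at 0)"
      using deriv[OF in_B[OF t] y] by (simp add: algebra_simps)
    then show "((\<lambda>t. K (x + t *\<^sub>R e) y) has_real_derivative D (x + t *\<^sub>R e) y) (at t)"
      using DERIV_shift[of "\<lambda>s. K (x + s *\<^sub>R e) y" _ 0 t] by simp
  qed
  then show ?thesis by simp
qed

text \<open>
  With \<open>q = |x - y|\<^sup>2\<close>, differentiating \<open>q\<^bsup>-b\<^esup>\<close> twice in each coordinate direction of \<open>x\<close> and summing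
  gives \<open>\<Delta> q\<^bsup>-b\<^esup> = 2b (2b + 2 - N) q\<^bsup>-b-1\<^esup>\<close>. The factor \<open>- 2b\<close> of the first derivative is divided out
  before the second differentiation, so that the sum appears below as \<open>(N - 2b - 2) q\<^bsup>-b-1\<^esup>\<close>.
\<close>

lemma riesz_power_step:
  assumes b: "0 < b" "2 * b + 2 \<noteq> real DIM('a)"
    and zero: "\<And>x. x \<in> B \<Longrightarrow> (\<integral>y. f y * ((x - y) \<bullet> (x - y)) powr (- b) \<partial>M) = 0"
    and x: "x \<in> B"
  shows "(\<integral>y. f y * ((x - y) \<bullet> (x - y)) powr (- b - 1) \<partial>M) = 0"
proof -
  define D where "D e x y = ((x - y) \<bullet> (x - y)) powr (- b - 1)
      + ((x - y) \<bullet> e) * (2 * (- b - 1) * ((x - y) \<bullet> e) * ((x - y) \<bullet> (x - y)) powr (- b - 1 - 1))"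
    for e x y :: 'a
  define C where "C c = d\<^sup>2 powr c" for c
  have C: "0 \<le> C c" for c by (simp add: C_def)
  have kb: "\<bar>((x - y) \<bullet> (x - y)) powr c\<bar> \<le> C c" if "x \<in> B" "y \<in> space M" "c \<le> 0" for x y c
    unfolding C_def using kernel_bound[OF that] .
  have first: "(\<integral>y. f y * (((x - y) \<bullet> e) * ((x - y) \<bullet> (x - y)) powr (- b - 1)) \<partial>M) = 0"
    if "x \<in> B" and e: "e \<in> Basis" for x e
  proof -
    have "(\<integral>y. f y * (2 * (- b) * ((x - y) \<bullet> e) * ((x - y) \<bullet> (x - y)) powr (- b - 1)) \<partial>M) = 0"
    proof (rule directional_derivative_annihilated[where K = "\<lambda>x y. ((x - y) \<bullet> (x - y)) powr (- b)"
          and D = "\<lambda>x y. 2 * (- b) * ((x - y) \<bullet> e) * ((x - y) \<bullet> (x - y)) powr (- b - 1)"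
          and e = e])
      fix x y assume xy: "x \<in> B" "y \<in> space M"
      show "((\<lambda>t. ((x + t *\<^sub>R e - y) \<bullet> (x + t *\<^sub>R e - y)) powr (- b)) has_real_derivative
          2 * (- b) * ((x - y) \<bullet> e) * ((x - y) \<bullet> (x - y)) powr (- b - 1)) (at 0)"
        using DERIV_inner_self_powr[OF dist_sq_bounds(4)[OF xy]] .
      show "\<bar>((x - y) \<bullet> (x - y)) powr (- b)\<bar> \<le> C (- b)"
        using xy b by (intro kb) auto
      show "\<bar>2 * (- b) * ((x - y) \<bullet> e) * ((x - y) \<bullet> (x - y)) powr (- b - 1)\<bar>
              \<le> 2 * b * (2 * R) * C (- b - 1)"
        unfolding abs_mult using b R C
        by (intro mult_mono component_bound[OF xy e] kb[OF xy]) auto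
    qed (use that zero in \<open>auto intro: measurable_kernel\<close>)
    also have "(\<lambda>y. f y * (2 * (- b) * ((x - y) \<bullet> e) * ((x - y) \<bullet> (x - y)) powr (- b - 1)))
        = (\<lambda>y. - 2 * b * (f y * (((x - y) \<bullet> e) * ((x - y) \<bullet> (x - y)) powr (- b - 1))))"
      by (simp add: fun_eq_iff algebra_simps)
    finally show ?thesis using b by simp
  qed
  have second: "(\<integral>y. f y * D e x y \<partial>M) = 0" and second_int: "integrable M (\<lambda>y. f y * D e x y)"
    if e: "e \<in> Basis" for e
  proof -
    have D_bound: "\<bar>D e x y\<bar> \<le> C (- b - 1) + 2 * R * (2 * (b + 1) * (2 * R) * C (- b - 1 - 1))"
      if xy: "x \<in> B" "y \<in> space M" for x y
    proof -
      have "\<bar>2 * (- b - 1)\<bar> = 2 * (b + 1)" using b by simp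
      then have "\<bar>((x - y) \<bullet> e) * (2 * (- b - 1) * ((x - y) \<bullet> e) * ((x - y) \<bullet> (x - y)) powr (- b - 1 - 1))\<bar>
          \<le> 2 * R * (2 * (b + 1) * (2 * R) * C (- b - 1 - 1))"
        unfolding abs_mult[of "_ \<bullet> _"] abs_mult[of "_ * _"] abs_mult[of "2 * _" "_ \<bullet> _"] using b R C
        by (intro mult_mono component_bound[OF xy e] kb[OF xy]) auto
      moreover have "\<bar>((x - y) \<bullet> (x - y)) powr (- b - 1)\<bar> \<le> C (- b - 1)"
        using b by (intro kb xy) auto
      ultimately show ?thesis unfolding D_def by linarith
    qed
    have [measurable]: "D e x \<in> borel_measurable M"
      unfolding D_def by (intro borel_measurable_add borel_measurable_times measurable_kernel) auto
    show "integrable M (\<lambda>y. f y * D e x y)"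
      by (rule integrable_times_bounded[OF f _ D_bound]) (use x in auto)
    show "(\<integral>y. f y * D e x y \<partial>M) = 0"
    proof (rule directional_derivative_annihilated[where
          K = "\<lambda>x y. ((x - y) \<bullet> e) * ((x - y) \<bullet> (x - y)) powr (- b - 1)", OF _ _ _ D_bound first[OF _ e] x])
      fix x y assume xy: "x \<in> B" "y \<in> space M"
      show "\<bar>((x - y) \<bullet> e) * ((x - y) \<bullet> (x - y)) powr (- b - 1)\<bar> \<le> 2 * R * C (- b - 1)"
        unfolding abs_mult[of "_ \<bullet> _"] using b R C
        by (intro mult_mono component_bound[OF xy e] kb[OF xy]) auto
      have "((\<lambda>t. (x + t *\<^sub>R e - y) \<bullet> e) has_real_derivative 1) (at 0)"
        using e by (auto simp: inner_simps intro!: derivative_eq_intros)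
      from DERIV_mult[OF this DERIV_inner_self_powr[OF dist_sq_bounds(4)[OF xy], of e "- b - 1"]]
      show "((\<lambda>t. ((x + t *\<^sub>R e - y) \<bullet> e) * ((x + t *\<^sub>R e - y) \<bullet> (x + t *\<^sub>R e - y)) powr (- b - 1))
          has_real_derivative D e x y) (at 0)"
        by (simp add: D_def mult.commute add.commute)
    qed (auto intro!: borel_measurable_times measurable_kernel)
  qed
  have sum_D: "(\<Sum>e\<in>Basis. D e x y) = (real DIM('a) - 2 * b - 2) * ((x - y) \<bullet> (x - y)) powr (- b - 1)"
    if y: "y \<in> space M" for y
  proof -
    let ?q = "(x - y) \<bullet> (x - y)"
    have q: "0 < ?q" using dist_sq_bounds(3)[OF x y] .
    have "D e x y = ?q powr (- b - 1)
        + (2 * (- b - 1) * ?q powr (- b - 1 - 1)) * (((x - y) \<bullet> e) * ((x - y) \<bullet> e))" for e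
      unfolding D_def by (simp only: mult_ac)
    then have "(\<Sum>e\<in>Basis. D e x y) = real DIM('a) * ?q powr (- b - 1)
        + 2 * (- b - 1) * ?q powr (- b - 1 - 1) * (\<Sum>e\<in>Basis. ((x - y) \<bullet> e) * ((x - y) \<bullet> e))"
      by (simp only: sum.distrib sum_distrib_left[symmetric] sum_constant)
    also have "(\<Sum>e\<in>Basis. ((x - y) \<bullet> e) * ((x - y) \<bullet> e)) = ?q"
      by (rule euclidean_inner[symmetric])
    also have "2 * (- b - 1) * ?q powr (- b - 1 - 1) * ?q = 2 * (- b - 1) * ?q powr (- b - 1)"
    proof -
      have "1 + (- b - 1 - 1) = - b - 1" by simp
      then have "?q powr (- b - 1 - 1) * ?q = ?q powr (- b - 1)"
        using powr_mult_base[of ?q "- b - 1 - 1"] q by (metis less_imp_le mult.commute)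
      then show ?thesis by (simp only: mult.assoc)
    qed
    finally show ?thesis by (simp add: algebra_simps)
  qed
  have "0 = (\<Sum>e\<in>Basis. \<integral>y. f y * D e x y \<partial>M)"
    using second by simp
  also have "\<dots> = (\<integral>y. (\<Sum>e\<in>Basis. f y * D e x y) \<partial>M)"
    by (rule Bochner_Integration.integral_sum[symmetric]) (rule second_int)
  also have "\<dots> = (\<integral>y. (real DIM('a) - 2 * b - 2) * (f y * ((x - y) \<bullet> (x - y)) powr (- b - 1)) \<partial>M)"
    by (rule Bochner_Integration.integral_cong)
      (simp_all add: sum_distrib_left[symmetric] sum_D mult_ac)
  finally show ?thesis using b by simp
qed

text \<open>
  The Laplacian can be iterated without end since \<open>N - 2(b + n) - 2\<close> stays negative when
  \<open>N \<le> 2b\<close>.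
\<close>

lemma riesz_powers_annihilated:
  assumes b: "0 < b" "real DIM('a) \<le> 2 * b"
    and zero: "\<And>x. x \<in> B \<Longrightarrow> (\<integral>y. f y * ((x - y) \<bullet> (x - y)) powr (- b) \<partial>M) = 0"
    and x: "x \<in> B"
  shows "(\<integral>y. f y * ((x - y) \<bullet> (x - y)) powr (- b - real n) \<partial>M) = 0"
  using x
proof (induction n arbitrary: x)
  case 0
  then show ?case using zero by simp
next
  case (Suc n)
  have "(\<integral>y. f y * ((x - y) \<bullet> (x - y)) powr (- (b + real n) - 1) \<partial>M) = 0"
    by (rule riesz_power_step) (use b Suc in auto)
  moreover have "- (b + real n) - 1 = - b - real (Suc n)" by simp
  ultimately show ?case by metis
qed

text \<open>
  For fixed \<open>x\<close> the weighted source \<open>f q\<^bsup>-b\<^esup>\<close> annihilates all powers of \<open>u = 1 / q\<close>, hence all continuous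
  functions of \<open>u\<close> on the compact interval of values of \<open>u\<close>. The function \<open>u\<^bsup>-b\<^esup> exp (-1 / u)\<close> cancels
  the weight and leaves the Gaussian.
\<close>

lemma gaussian_annihilated:
  assumes b: "0 < b" "real DIM('a) \<le> 2 * b"
    and zero: "\<And>x. x \<in> B \<Longrightarrow> (\<integral>y. f y * ((x - y) \<bullet> (x - y)) powr (- b) \<partial>M) = 0"
    and x: "x \<in> B"
  shows "(\<integral>y. f y * exp (- ((x - y) \<bullet> (x - y))) \<partial>M) = 0"
proof -
  let ?q = "\<lambda>y. (x - y) \<bullet> (x - y)"
  have int: "integrable M (\<lambda>y. f y * ?q y powr c)" if "c \<le> 0" for c
    by (rule integrable_times_bounded[OF f measurable_kernel(1)])
      (use kernel_bound[OF x _ that] in auto)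
  have "(\<integral>y. (f y * ?q y powr (- b)) * (\<lambda>u. u powr (- b) * exp (- (1 / u))) (1 / ?q y) \<partial>M) = 0"
  proof (rule continuous_annihilated_if_polynomials_annihilated[where S = "{1 / (2 * R)\<^sup>2 .. 1 / d\<^sup>2}"
        and u = "\<lambda>y. 1 / ?q y" and h = "\<lambda>u. u powr (- b) * exp (- (1 / u))"])
    show "integrable M (\<lambda>y. f y * ?q y powr (- b))" using int b by simp
    have [measurable]: "?q \<in> borel_measurable M"
      by (intro measurable_continuous continuous_intros)
    show "(\<lambda>y. 1 / ?q y) \<in> borel_measurable M" by measurable
    show "1 / ?q y \<in> {1 / (2 * R)\<^sup>2 .. 1 / d\<^sup>2}" if "y \<in> space M" for y
    proof -
      have "0 < d\<^sup>2" using d by simp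
      with dist_sq_bounds[OF x that] show ?thesis
        unfolding atLeastAtMost_iff by (intro conjI divide_left_mono mult_pos_pos) linarith+
    qed
    have "0 < 1 / (2 * R)\<^sup>2" using R by simp
    then have pos: "u \<noteq> 0" if "u \<in> {1 / (2 * R)\<^sup>2 .. 1 / d\<^sup>2}" for u :: real
      using that by auto
    then show "continuous_on {1 / (2 * R)\<^sup>2 .. 1 / d\<^sup>2} (\<lambda>u. u powr (- b) * exp (- (1 / u)))"
      by (intro continuous_intros) auto
    fix p :: "real \<Rightarrow> real" assume "real_polynomial_function p"
    then obtain a n where p: "p = (\<lambda>u. \<Sum>i\<le>n. a i * u ^ i)"
      unfolding real_polynomial_function_iff_sum by blast
    have "(\<integral>y. f y * ?q y powr (- b) * p (1 / ?q y) \<partial>M)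
        = (\<integral>y. (\<Sum>i\<le>n. a i * (f y * ?q y powr (- b - real i))) \<partial>M)"
    proof (rule Bochner_Integration.integral_cong)
      fix y assume y: "y \<in> space M"
      have "?q y powr (- b) * (1 / ?q y) ^ i = ?q y powr (- b - real i)" for i
        using dist_sq_bounds(3)[OF x y] by (simp add: powr_diff powr_realpow power_one_over)
      then have "f y * ?q y powr (- b) * (a i * (1 / ?q y) ^ i)
          = a i * (f y * ?q y powr (- b - real i))" for i
        by (metis mult.assoc mult.left_commute)
      then show "f y * ?q y powr (- b) * p (1 / ?q y)
          = (\<Sum>i\<le>n. a i * (f y * ?q y powr (- b - real i)))"
        unfolding p sum_distrib_left by (simp only:)
    qed simp
    also have "\<dots> = (\<Sum>i\<le>n. \<integral>y. a i * (f y * ?q y powr (- b - real i)) \<partial>M)"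
      by (rule Bochner_Integration.integral_sum) (use int b in simp)
    also have "\<dots> = 0"
      using riesz_powers_annihilated[OF b zero x] by simp
    finally show "(\<integral>y. f y * ?q y powr (- b) * p (1 / ?q y) \<partial>M) = 0" .
  qed simp
  also have "(\<integral>y. (f y * ?q y powr (- b)) * (\<lambda>u. u powr (- b) * exp (- (1 / u))) (1 / ?q y) \<partial>M)
      = (\<integral>y. f y * exp (- ?q y) \<partial>M)"
    by (rule Bochner_Integration.integral_cong)
      (use dist_sq_bounds(3)[OF x] in \<open>auto simp: powr_divide powr_minus\<close>)
  finally show ?thesis .
qed

text \<open>
  The Gaussian is singled out among the functions of \<open>|x - y|\<close> because it factors into a function
  of \<open>x\<close>, a function of \<open>y\<close> and an exponential, and the first of these can be dropped.
\<close>

lemma exponential_annihilated: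
  assumes gauss: "\<And>x. x \<in> B \<Longrightarrow> (\<integral>y. f y * exp (- ((x - y) \<bullet> (x - y))) \<partial>M) = 0"
    and x: "x \<in> B"
  shows "(\<integral>y. f y * (exp (- (y \<bullet> y)) * exp (2 * (x \<bullet> y))) \<partial>M) = 0"
proof -
  have "f y * (exp (- (y \<bullet> y)) * exp (2 * (x \<bullet> y)))
      = exp (x \<bullet> x) * (f y * exp (- ((x - y) \<bullet> (x - y))))" for y
    by (simp add: inner_simps inner_commute algebra_simps flip: exp_add)
  then have "(\<integral>y. f y * (exp (- (y \<bullet> y)) * exp (2 * (x \<bullet> y))) \<partial>M)
      = (\<integral>y. exp (x \<bullet> x) * (f y * exp (- ((x - y) \<bullet> (x - y)))) \<partial>M)"
    by metis
  then show ?thesis using gauss[OF x] by simp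
qed

lemma continuous_bounded_on_source:
  fixes w :: "'a \<Rightarrow> real"
  assumes "continuous_on UNIV w"
  obtains C where "0 \<le> C" "\<And>y. y \<in> space M \<Longrightarrow> \<bar>w y\<bar> \<le> C"
proof -
  have "compact (w ` cball 0 R)"
    by (intro compact_continuous_image continuous_on_subset[OF assms]) auto
  then obtain C where "\<forall>y \<in> cball 0 R. \<bar>w y\<bar> \<le> C"
    using compact_imp_bounded by (fastforce simp: bounded_iff)
  then have "\<bar>w y\<bar> \<le> max 0 C" if "y \<in> space M" for y
    using norm_source[OF that] by (simp add: max.coboundedI2)
  then show ?thesis using that[of "max 0 C"] by simp
qed

lemma exp_inner_bound:
  assumes "x \<in> B" "y \<in> space M"
  shows "exp (2 * (x \<bullet> y)) \<le> exp (2 * (R * R))"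
proof -
  have "x \<bullet> y \<le> norm x * norm y" by (rule norm_cauchy_schwarz)
  also have "\<dots> \<le> R * R"
    using norm_obs[OF assms(1)] norm_source[OF assms(2)] R by (intro mult_mono) auto
  finally show ?thesis by simp
qed

lemma integrable_exponential_weight:
  assumes "continuous_on UNIV w"
  shows "integrable M (\<lambda>y. f y * (w y * exp (2 * (x \<bullet> y))))"
proof -
  have cont: "continuous_on UNIV (\<lambda>y. w y * exp (2 * (x \<bullet> y)))"
    by (intro continuous_intros assms(1))
  obtain C where C: "\<And>y. y \<in> space M \<Longrightarrow> \<bar>w y * exp (2 * (x \<bullet> y))\<bar> \<le> C"
    using continuous_bounded_on_source[OF cont] by blast
  show ?thesis
    by (rule integrable_times_bounded[OF f measurable_continuous[OF cont] C])
qed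

text \<open>
  Differentiating \<open>exp (2 x \<bullet> y)\<close> in \<open>x\<close> in the direction \<open>e\<close> multiplies it by \<open>2 e \<bullet> y\<close>, and every
  linear form of \<open>y\<close> is of this kind. The weight \<open>w\<close> is arbitrary in the induction so that
  a product of polynomials can be handled by absorbing one factor into the weight. Annihilation
  is required at all points of \<open>B\<close>, as it has to be differentiated again.
\<close>

lemma polynomial_exponential_annihilated:
  fixes w p :: "'a \<Rightarrow> real"
  assumes "real_polynomial_function p" and "continuous_on UNIV w"
    and "\<And>x. x \<in> B \<Longrightarrow> (\<integral>y. f y * (w y * exp (2 * (x \<bullet> y))) \<partial>M) = 0"
    and "x \<in> B"
  shows "(\<integral>y. f y * (w y * p y * exp (2 * (x \<bullet> y))) \<partial>M) = 0"
  using assms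
proof (induction p arbitrary: w x rule: real_polynomial_function.induct)
  case (linear p)
  \<comment> \<open>the Riesz representative of the linear form \<open>p\<close>\<close>
  define e where "e = (\<Sum>b\<in>Basis. p b *\<^sub>R b)"
  have p: "p y = e \<bullet> y" for y
  proof -
    have "p y = p (\<Sum>b\<in>Basis. (y \<bullet> b) *\<^sub>R b)" by (simp add: euclidean_representation)
    also have "\<dots> = (\<Sum>b\<in>Basis. (y \<bullet> b) * p b)"
      using linear(1) by (simp add: bounded_linear.linear linear_sum linear_cmul)
    also have "\<dots> = e \<bullet> y"
      by (simp add: e_def inner_sum_left inner_commute[of y] mult.commute)
    finally show ?thesis .
  qed
  have cont_p: "continuous_on UNIV p" unfolding p by (intro continuous_intros)
  obtain C where C: "0 \<le> C" "\<And>y. y \<in> space M \<Longrightarrow> \<bar>w y\<bar> \<le> C"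
    using continuous_bounded_on_source[OF linear(2)] by blast
  obtain C' where C': "0 \<le> C'" "\<And>y. y \<in> space M \<Longrightarrow> \<bar>w y * p y\<bar> \<le> C'"
    using continuous_bounded_on_source[OF continuous_on_mult[OF linear(2) cont_p]] by blast
  have "(\<integral>y. f y * (w y * p y * (2 * exp (2 * (x \<bullet> y)))) \<partial>M) = 0"
  proof (rule directional_derivative_annihilated[where
        K = "\<lambda>x y. w y * exp (2 * (x \<bullet> y))" and e = e, OF _ _ _ _ linear(3,4)])
    fix x y assume xy: "x \<in> B" "y \<in> space M"
    show "\<bar>w y * exp (2 * (x \<bullet> y))\<bar> \<le> C * exp (2 * (R * R))"
      unfolding abs_mult using C xy exp_inner_bound by (intro mult_mono) auto
    show "\<bar>w y * p y * (2 * exp (2 * (x \<bullet> y)))\<bar> \<le> C' * (2 * exp (2 * (R * R)))"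
      unfolding abs_mult[of "w y * p y"] using C' xy exp_inner_bound by (intro mult_mono) auto
    show "((\<lambda>t. w y * exp (2 * ((x + t *\<^sub>R e) \<bullet> y))) has_real_derivative
        w y * p y * (2 * exp (2 * (x \<bullet> y)))) (at 0)"
      unfolding p inner_simps by (auto intro!: derivative_eq_intros)
  qed (intro measurable_continuous continuous_intros linear(2))
  also have "(\<lambda>y. f y * (w y * p y * (2 * exp (2 * (x \<bullet> y)))))
      = (\<lambda>y. 2 * (f y * (w y * p y * exp (2 * (x \<bullet> y)))))"
    by (simp add: fun_eq_iff)
  finally show ?case by simp
next
  case (const c)
  have "(\<lambda>y. f y * (w y * c * exp (2 * (x \<bullet> y)))) = (\<lambda>y. c * (f y * (w y * exp (2 * (x \<bullet> y)))))"
    by (simp add: fun_eq_iff)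
  then show ?case using const by simp
next
  case (add p q)
  have cont: "continuous_on UNIV p" "continuous_on UNIV q"
    using add(1,2) real_polynomial_function_eq continuous_on_polymonial_function by blast+
  have "(\<integral>y. f y * (w y * (p y + q y) * exp (2 * (x \<bullet> y))) \<partial>M)
      = (\<integral>y. f y * (w y * p y * exp (2 * (x \<bullet> y))) + f y * (w y * q y * exp (2 * (x \<bullet> y))) \<partial>M)"
    by (simp add: algebra_simps)
  also have "\<dots> = (\<integral>y. f y * (w y * p y * exp (2 * (x \<bullet> y))) \<partial>M)
      + (\<integral>y. f y * (w y * q y * exp (2 * (x \<bullet> y))) \<partial>M)"
    by (intro Bochner_Integration.integral_add integrable_exponential_weight
        continuous_on_mult add.prems cont)
  also have "\<dots> = 0"
    using add.IH add.prems by simp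
  finally show ?case .
next
  case (mult p q)
  have cont: "continuous_on UNIV (\<lambda>y. w y * p y)"
    using mult(1) mult.prems(1) real_polynomial_function_eq continuous_on_polymonial_function
    by (blast intro: continuous_on_mult)
  have "(\<integral>y. f y * (w y * p y * q y * exp (2 * (x \<bullet> y))) \<partial>M) = 0"
    by (rule mult.IH(2)[OF cont mult.IH(1)[OF mult.prems(1,2)] mult.prems(3)])
  then show ?case by (simp add: mult.assoc)
qed

text \<open>
  The potential is continuous on \<open>B\<close>, and the complement of a null set is dense there.
\<close>

lemma riesz_potential_vanishes_everywhere:
  assumes c: "c \<le> 0"
    and zero: "AE x in lebesgue. x \<in> B \<longrightarrow> (\<integral>y. f y * ((x - y) \<bullet> (x - y)) powr c \<partial>M) = 0"
    and x: "x \<in> B"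
  shows "(\<integral>y. f y * ((x - y) \<bullet> (x - y)) powr c \<partial>M) = 0"
proof -
  let ?F = "\<lambda>x. \<integral>y. f y * ((x - y) \<bullet> (x - y)) powr c \<partial>M"
  obtain N where N: "negligible N" and good: "\<And>x. x \<notin> N \<Longrightarrow> x \<in> B \<Longrightarrow> ?F x = 0"
    using zero by (auto elim!: AE_E3 simp: negligible_iff_null_sets)
  have "\<exists>z. z \<in> B \<and> dist x z < 1 / real (Suc n) \<and> z \<notin> N" for n
  proof -
    have "open (B \<inter> ball x (1 / real (Suc n)))" "B \<inter> ball x (1 / real (Suc n)) \<noteq> {}"
      using B x by (auto intro!: exI[of _ x])
    then have "\<not> B \<inter> ball x (1 / real (Suc n)) \<subseteq> N"
      using N open_not_negligible negligible_subset by blast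
    then show ?thesis by auto
  qed
  then obtain z where z: "\<And>n. z n \<in> B" "\<And>n. dist x (z n) < 1 / real (Suc n)" "\<And>n. z n \<notin> N"
    by metis
  have z_lim: "z \<longlonglongrightarrow> x"
  proof (rule metric_LIMSEQ_I)
    fix r :: real assume "0 < r"
    then obtain n where n: "1 / real (Suc n) < r" using nat_approx_posE by blast
    have "dist (z m) x < r" if "m \<ge> n" for m
    proof -
      have "1 / real (Suc m) \<le> 1 / real (Suc n)" using that by (simp add: frac_le)
      then show ?thesis using z(2)[of m] n by (simp add: dist_commute)
    qed
    then show "\<exists>n. \<forall>m\<ge>n. dist (z m) x < r" by blast
  qed
  have [measurable]: "f \<in> borel_measurable M" using f by measurable
  note measurable_kernel(1)[measurable]
  have "(\<lambda>n. ?F (z n)) \<longlonglongrightarrow> ?F x"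
  proof (rule integral_dominated_convergence)
    show "integrable M (\<lambda>y. d\<^sup>2 powr c * \<bar>f y\<bar>)" using f by simp
    show "AE y in M. (\<lambda>n. f y * ((z n - y) \<bullet> (z n - y)) powr c)
        \<longlonglongrightarrow> f y * ((x - y) \<bullet> (x - y)) powr c"
      using dist_sq_bounds(3,4)[OF x] by (intro AE_I2 tendsto_intros z_lim) auto
    show "AE y in M. norm (f y * ((z n - y) \<bullet> (z n - y)) powr c) \<le> d\<^sup>2 powr c * \<bar>f y\<bar>" for n
      using kernel_bound[OF z(1) _ c]
      by (auto simp: abs_mult mult.commute[of "d\<^sup>2 powr c"] intro!: mult_left_mono)
  qed measurable
  then show ?thesis
    using good[OF z(3,1)] by (simp add: LIMSEQ_const_iff)
qed

text \<open>
  A single point \<open>x\<close> of \<open>B\<close> suffices at the end: the weight \<open>w\<close> has no zeros, so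
  Stone-Weierstrass can be applied to \<open>h / w\<close> with the source \<open>f w\<close>.
\<close>

lemma continuous_annihilated_if_riesz_potential_vanishes:
  fixes h :: "'a \<Rightarrow> real"
  assumes b: "0 < b" "real DIM('a) \<le> 2 * b"
    and nonempty: "B \<noteq> {}"
    and zero: "\<And>x. x \<in> B \<Longrightarrow> (\<integral>y. f y * ((x - y) \<bullet> (x - y)) powr (- b) \<partial>M) = 0"
    and h: "continuous_on UNIV h"
  shows "(\<integral>y. f y * h y \<partial>M) = 0"
proof -
  obtain x where x: "x \<in> B" using nonempty by blast
  define w where "w y = exp (- (y \<bullet> y)) * exp (2 * (x \<bullet> y))" for y
  have w_pos: "w y \<noteq> 0" for y by (simp add: w_def)
  have w_cont: "continuous_on UNIV w" unfolding w_def by (intro continuous_intros)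
  have gauss_cont: "continuous_on UNIV (\<lambda>y::'a. exp (- (y \<bullet> y)))"
    by (intro continuous_intros)
  have "(\<integral>y. (f y * w y) * (\<lambda>y. h y / w y) y \<partial>M) = 0"
  proof (rule continuous_annihilated_if_polynomials_annihilated[where u = "\<lambda>y. y" and S = "cball 0 R"])
    show "integrable M (\<lambda>y. f y * w y)"
      unfolding w_def by (rule integrable_exponential_weight[OF gauss_cont])
    show "continuous_on (cball 0 R) (\<lambda>y. h y / w y)"
      using w_pos by (intro continuous_on_divide continuous_on_subset[OF h]
          continuous_on_subset[OF w_cont]) auto
    fix p :: "'a \<Rightarrow> real" assume "real_polynomial_function p"
    from polynomial_exponential_annihilated[OF this gauss_cont
        exponential_annihilated[OF gaussian_annihilated[OF b zero]] x]
    show "(\<integral>y. f y * w y * p y \<partial>M) = 0"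
      by (simp add: w_def mult_ac)
  qed (use id_measurable norm_source in auto)
  then show ?thesis using w_pos by simp
qed

end


section \<open>Eigenfunctions with vanishing nonlocal normal derivative\<close>

lemma frac_const_pos:
  assumes "0 < s" "s < 1"
  shows "0 < frac_const N s"
  unfolding frac_const_def using assms
  by (intro divide_pos_pos mult_pos_pos Gamma_real_pos) auto

lemma inner_self_powr_eq_norm_powr: "(z \<bullet> z) powr (- (p / 2)) = 1 / norm z powr p"
proof (cases "z = 0")
  case False
  then have "(z \<bullet> z) powr (- (p / 2)) = (norm z powr 2) powr (- (p / 2))"
    by (simp add: dot_square_norm)
  also have "\<dots> = 1 / norm z powr p"
    unfolding powr_powr by (simp add: powr_minus_divide)
  finally show ?thesis .
qed simp

lemma L2_fun_integrable_on_bounded: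
  assumes "\<phi> \<in> L2_fun lebesgue" and S: "S \<in> lmeasurable"
  shows "integrable (lebesgue_on S) \<phi>"
proof (rule Bochner_Integration.integrable_bound)
  have \<phi>: "\<phi> \<in> borel_measurable lebesgue" "integrable lebesgue (\<lambda>x. (\<phi> x)\<^sup>2)"
    using assms(1) by (auto simp: L2_fun_def)
  have sets: "S \<in> sets lebesgue" using S by (simp add: fmeasurableD)
  interpret finite_measure "lebesgue_on S" using S by (rule finite_measure_lebesgue_on)
  have "integrable (lebesgue_on S) (\<lambda>x. (\<phi> x)\<^sup>2)"
    using integrable_mult_indicator[OF sets \<phi>(2)] sets by (simp add: integrable_restrict_space)
  then show "integrable (lebesgue_on S) (\<lambda>x. 1 + (\<phi> x)\<^sup>2)" by simp
  show "\<phi> \<in> borel_measurable (lebesgue_on S)"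
    using \<phi>(1) by (rule measurable_restrict_space1)
  have "\<bar>t\<bar> \<le> 1 + t\<^sup>2" for t :: real
    using zero_le_power2[of "\<bar>t\<bar> - 1"] unfolding power2_diff by simp
  then show "AE x in lebesgue_on S. norm (\<phi> x) \<le> norm (1 + (\<phi> x)\<^sup>2)"
    by (auto simp: abs_of_nonneg add_nonneg_nonneg)
qed

theorem theorem3p10:
  fixes \<Omega> \<O> :: "'a::euclidean_space set" and s lam :: real and \<phi> :: "'a \<Rightarrow> real"
  assumes "open \<Omega>" and "connected \<Omega>" and "\<Omega> \<noteq> {}" and "bounded \<Omega>"
    and "lipschitz_boundary \<Omega>"
    and "0 < s" and "s < 1"
    and "open \<O>" and "\<O> \<noteq> {}" and "\<O> \<subseteq> - \<Omega>"
    and "lam > 0"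
    and "\<phi> \<in> dirichlet_frac_laplacian_dom s \<Omega>"
    and "dirichlet_frac_laplacian s \<Omega> \<phi> (\<lambda>x. lam * \<phi> x)"
    and "AE x in lebesgue. x \<in> \<O> \<longrightarrow> nonlocal_normal_deriv s \<Omega> \<phi> x = 0"
  shows "AE x in lebesgue. \<phi> x = 0"
proof -
  have L2: "\<phi> \<in> L2_fun lebesgue" and outside: "AE x in lebesgue. x \<notin> \<Omega> \<longrightarrow> \<phi> x = 0"
    using assms(13) by (auto simp: dirichlet_frac_laplacian_def frac_sobolev0_def frac_sobolev_def)
  have \<Omega>: "\<Omega> \<in> lmeasurable" using assms(4,1) by (rule lmeasurable_open)
  then have \<Omega>_sets: "\<Omega> \<in> sets lebesgue" by (simp add: fmeasurableD)
  have int: "integrable (lebesgue_on \<Omega>) \<phi>"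
    using L2 \<Omega> by (rule L2_fun_integrable_on_bounded)
  define b where "b = (real DIM('a) + 2 * s) / 2"
  have b: "0 < b" "real DIM('a) \<le> 2 * b" using assms(6) by (auto simp: b_def add_nonneg_pos)
  obtain x0 \<epsilon> where \<epsilon>: "0 < \<epsilon>" "ball x0 \<epsilon> \<subseteq> \<O>"
    using assms(8,9) open_contains_ball by blast
  obtain r where r: "\<And>y. y \<in> \<Omega> \<Longrightarrow> norm y \<le> r" "0 < r"
    using assms(4) unfolding bounded_pos by blast
  \<comment> \<open>half the radius, since \<open>\<O>\<close> itself may touch the boundary of \<open>\<Omega>\<close>\<close>
  define B where "B = ball x0 (\<epsilon> / 2)"
  define R where "R = r + norm x0 + \<epsilon>"
  have R: "0 < R" using r(2) \<epsilon>(1) by (simp add: R_def add_pos_nonneg)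
  have separated: "\<epsilon> / 2 \<le> norm (x - y)" if "x \<in> B" "y \<in> space (lebesgue_on \<Omega>)" for x y
  proof -
    have "y \<notin> ball x0 \<epsilon>" using that(2) \<epsilon>(2) assms(10) by auto
    then have "\<epsilon> \<le> dist x0 y" by simp
    also have "\<dots> \<le> dist x0 x + dist x y" by (rule dist_triangle)
    finally show ?thesis using that(1) by (simp add: B_def dist_norm)
  qed
  have norm_obs: "norm x \<le> R" if "x \<in> B" for x
  proof -
    have "norm x \<le> norm x0 + dist x0 x" using norm_triangle_sub[of x x0] by (simp add: dist_norm norm_minus_commute)
    then show ?thesis using that \<epsilon>(1) r(2) by (simp add: B_def R_def)
  qed
  have norm_source: "norm y \<le> R" if "y \<in> space (lebesgue_on \<Omega>)" for y
    using r(1)[of y] that \<epsilon>(1) norm_ge_zero[of x0] unfolding R_def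
    by (simp del: norm_ge_zero)
  have id_measurable: "(\<lambda>y. y) \<in> borel_measurable (lebesgue_on \<Omega>)"
    using continuous_imp_measurable_on_sets_lebesgue[OF continuous_on_id \<Omega>_sets] .
  have half: "0 < \<epsilon> / 2" using \<epsilon>(1) by simp
  note source = id_measurable int open_ball[of x0 "\<epsilon> / 2", folded B_def] half R separated norm_obs norm_source
  have "AE x in lebesgue. x \<in> B \<longrightarrow> (\<integral>y. \<phi> y * ((x - y) \<bullet> (x - y)) powr (- b) \<partial>lebesgue_on \<Omega>) = 0"
    using outside assms(14)
  proof eventually_elim
    fix x
    assume out: "x \<notin> \<Omega> \<longrightarrow> \<phi> x = 0" and deriv: "x \<in> \<O> \<longrightarrow> nonlocal_normal_deriv s \<Omega> \<phi> x = 0"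
    show "x \<in> B \<longrightarrow> (\<integral>y. \<phi> y * ((x - y) \<bullet> (x - y)) powr (- b) \<partial>lebesgue_on \<Omega>) = 0"
    proof
      assume "x \<in> B"
      then have "x \<in> \<O>" using \<epsilon> by (auto simp: B_def)
      then have "\<phi> x = 0" using out assms(10) by auto
      then have "nonlocal_normal_deriv s \<Omega> \<phi> x = - (frac_const DIM('a) s
          * (\<integral>y. \<phi> y * ((x - y) \<bullet> (x - y)) powr (- b) \<partial>lebesgue_on \<Omega>))"
        by (simp add: nonlocal_normal_deriv_def b_def inner_self_powr_eq_norm_powr del: minus_divide_left)
      then show "(\<integral>y. \<phi> y * ((x - y) \<bullet> (x - y)) powr (- b) \<partial>lebesgue_on \<Omega>) = 0"
        using deriv \<open>x \<in> \<O>\<close> frac_const_pos[OF assms(6,7), of "DIM('a)"] by simp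
    qed
  qed
  then have potential: "(\<integral>y. \<phi> y * ((x - y) \<bullet> (x - y)) powr (- b) \<partial>lebesgue_on \<Omega>) = 0"
    if "x \<in> B" for x
    using riesz_potential_vanishes_everywhere[OF source, of "- b" x] b that by simp
  have "B \<noteq> {}" using \<epsilon>(1) by (auto simp: B_def)
  then have "AE y in lebesgue_on \<Omega>. \<phi> y = 0"
    using continuous_annihilated_if_riesz_potential_vanishes[OF source b _ potential]
    by (intro AE_eq_0_if_continuous_annihilated[OF \<Omega>_sets int]) auto
  then have "AE y in lebesgue. y \<in> \<Omega> \<longrightarrow> \<phi> y = 0"
    using \<Omega>_sets by (simp add: AE_restrict_space_iff)
  with outside show ?thesis
    by eventually_elim blast
qed

end
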